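(* Let $n\ge 2$ and let $A=(a_{ij})\in M_R$ be a reciprocal pairwise comparison matrix of order $n$. Then $RIC(A)>0$ if and only if $A$ is not consistent, i.e. $A\notin M_C$.
   Context: $M_R$ is the set of all real $n\times n$ matrices $A=(a_{ij})$ with $a_{ij}>0$ for all $i,j$ and $a_{ij}=1/a_{ji}$ for all $i,j$ (reciprocal matrices). $M_C$ is the set of all real $n\times n$ matrices with $a_{ij}>0$ for all $i,j$ and $a_{ij}a_{jk}=a_{ik}$ for all $i,j,k$ (consistent matrices). For $A\in M_R$ let $r_i=(a_{i1},\dots,a_{in})$ be its $i$-th row, let $\varphi_{ij}$ be the angle between $r_i$ and $r_j$, so $\cos\varphi_{ij}=\frac{r_i\cdot r_j}{|r_i|\,|r_j|}$ (Euclidean dot product and norm). The row inconsistency index is $RIC(A)=1-\frac{2\sum_{i=1}^{n-1}\sum_{j=i+1}^{n}\cos\varphi_{ij}}{n(n-1)}$. *)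

theory Defs
  imports "HOL-Analysis.Analysis"
begin

definition reciprocal_matrices :: "(real ^ 'n ^ 'n) set" where
  "reciprocal_matrices =
     {A. (\<forall>i j. A $ i $ j > 0) \<and> (\<forall>i j. A $ i $ j = 1 / A $ j $ i)}"

definition consistent_matrices :: "(real ^ 'n ^ 'n) set" where
  "consistent_matrices =
     {A. (\<forall>i j. A $ i $ j > 0) \<and> (\<forall>i j k. A $ i $ j * A $ j $ k = A $ i $ k)}"

definition vector_angle :: "'a::real_inner \<Rightarrow> 'a \<Rightarrow> real" where
  "vector_angle u v = arccos ((u \<bullet> v) / (norm u * norm v))"

definition row_angle :: "real ^ 'n ^ 'n \<Rightarrow> 'n \<Rightarrow> 'n \<Rightarrow> real" where
  "row_angle A i j = vector_angle (row i A) (row j A)"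

lemma cos_vector_angle: "cos (vector_angle u v) = (u \<bullet> v) / (norm u * norm v)"
proof -
  have "\<bar>(u \<bullet> v) / (norm u * norm v)\<bar> \<le> 1"
    using Cauchy_Schwarz_ineq2[of u v] by (auto simp: abs_mult divide_le_eq_1)
  then show ?thesis
    unfolding vector_angle_def by (rule cos_arccos_abs)
qed

text \<open>The index type carries a linear order so that the sum can range over the pairs
  \<open>i < j\<close>. A finite linear order with \<open>n\<close> elements is a copy of \<open>{1..n}\<close>; the greatest
  index contributes an empty inner sum.\<close>

definition RIC :: "real ^ 'n::{finite,linorder} ^ 'n::{finite,linorder} \<Rightarrow> real" where
  "RIC A = 1 - 2 * (\<Sum>i\<in>UNIV. \<Sum>j\<in>{i<..}. cos (row_angle A i j))
               / (real CARD('n) * (real CARD('n) - 1))"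

end

theory Submission
  imports Defs
begin

text \<open>Up to the positive factor \<open>2 / (n (n - 1))\<close>, the index is the sum of the nonnegative terms
  \<open>1 - cos \<phi>\<^sub>i\<^sub>j\<close>. It therefore vanishes iff equality holds in the Cauchy--Schwarz
  inequality for all pairs of rows, i.e. iff the rows are pairwise positive multiples of each
  other. As \<open>a\<^sub>j\<^sub>j = 1\<close>, the factor taking row \<open>j\<close> to row \<open>i\<close> must
  be \<open>a\<^sub>i\<^sub>j\<close>, and this is consistency.\<close>

text \<open>Double counting of the pairs \<open>i < j\<close>: summing by the smaller or by the
  larger index gives the same total, and the elements above and below a fixed \<open>i\<close>
  together number \<open>n - 1\<close>.\<close>

lemma sum_card_greaterThan:
  "2 * (\<Sum>i\<in>UNIV. real (card {i::'n::{finite,linorder}<..}))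
     = real CARD('n) * (real CARD('n) - 1)"
proof -
  have "(\<Sum>i\<in>UNIV. card {i::'n<..}) = (\<Sum>i\<in>UNIV. card {..<i::'n})"
  proof -
    have "(\<Sum>i\<in>UNIV. card {i::'n<..}) = (\<Sum>i\<in>UNIV. \<Sum>j\<in>{j\<in>UNIV. i < (j::'n)}. 1)"
      by (simp add: greaterThan_def)
    also have "\<dots> = (\<Sum>j\<in>UNIV. \<Sum>i\<in>{i\<in>UNIV. i < (j::'n)}. 1)"
      by (rule sum.swap_restrict) auto
    finally show ?thesis
      by (simp add: lessThan_def)
  qed
  then have "2 * (\<Sum>i\<in>UNIV. real (card {i::'n<..}))
      = (\<Sum>i\<in>UNIV. real (card {i::'n<..})) + (\<Sum>i\<in>UNIV. real (card {..<i::'n}))"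
    by (simp flip: of_nat_sum)
  also have "\<dots> = (\<Sum>i\<in>(UNIV :: 'n set). real CARD('n) - 1)"
    unfolding sum.distrib [symmetric]
  proof (rule sum.cong [OF refl])
    fix i :: 'n
    have "card {i<..} + card {..<i} = card ({i<..} \<union> {..<i})"
      by (rule card_Un_disjoint [symmetric]) auto
    also have "{i<..} \<union> {..<i} = UNIV - {i}"
      by auto
    finally have "card {i<..} + card {..<i} + 1 = CARD('n)"
      by (simp add: card_Diff_singleton)
    then show "real (card {i::'n::{finite,linorder}<..}) + real (card {..<i}) = real CARD('n) - 1"
      by linarith
  qed
  finally show ?thesis
    by simp
qed

lemma row_angle_commute: "row_angle A i j = row_angle A j i"
  by (simp add: row_angle_def vector_angle_def inner_commute mult.commute)

text \<open>The equality case of Cauchy-Schwarz. For a zero vector the quotient would be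
  \<open>0 / 0 = 0\<close>, so the cosine would be 0 although the right-hand side holds.\<close>

lemma cos_vector_angle_eq_1_iff:
  assumes "u \<noteq> 0" "v \<noteq> 0"
  shows "cos (vector_angle u v) = 1 \<longleftrightarrow> norm u *\<^sub>R v = norm v *\<^sub>R u"
  using assms by (auto simp: cos_vector_angle simp flip: norm_cauchy_schwarz_eq)

lemma row_reciprocal_nonzero:
  assumes "A \<in> reciprocal_matrices"
  shows "row i A \<noteq> 0"
proof
  assume "row i A = 0"
  then have "A $ i $ i = 0"
    by (simp add: row_def vec_eq_iff)
  moreover have "A $ i $ i > 0"
    using assms unfolding reciprocal_matrices_def by blast
  ultimately show False
    by simp
qed

lemma consistent_iff_cos_row_angle:
  fixes A :: "real ^ 'n ^ 'n"
  assumes A: "A \<in> reciprocal_matrices"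
  shows "A \<in> consistent_matrices \<longleftrightarrow> (\<forall>i j. cos (row_angle A i j) = 1)"
proof -
  have pos: "A $ i $ j > 0" and rec: "A $ i $ j = 1 / A $ j $ i" for i j
    using A unfolding reciprocal_matrices_def by blast+
  have diag: "A $ j $ j = 1" for j
    using pos [of j j] rec [of j j] by (simp add: field_simps power2_eq_1_iff flip: power2_eq_square)
  have nz: "row i A \<noteq> 0" for i
    by (rule row_reciprocal_nonzero [OF A])
  have eq1: "cos (row_angle A i j) = 1
      \<longleftrightarrow> norm (row i A) *\<^sub>R row j A = norm (row j A) *\<^sub>R row i A" for i j
    unfolding row_angle_def by (rule cos_vector_angle_eq_1_iff [OF nz nz])
  show ?thesis
  proof (intro iffI allI)
    fix i j
    assume "A \<in> consistent_matrices"
    then have "row i A = A $ i $ j *\<^sub>R row j A"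
      by (simp add: consistent_matrices_def row_def vec_eq_iff)
    then show "cos (row_angle A i j) = 1"
      using pos [of i j] by (simp add: eq1)
  next
    assume *: "\<forall>i j. cos (row_angle A i j) = 1"
    have "A $ i $ j * A $ j $ k = A $ i $ k" for i j k
    proof -
      have "norm (row i A) *\<^sub>R row j A = norm (row j A) *\<^sub>R row i A"
        using * eq1 by blast
      then have scaled: "norm (row i A) * A $ j $ l = norm (row j A) * A $ i $ l" for l
        by (simp add: vec_eq_iff row_def)
      \<comment> \<open>As \<open>A $ j $ j = 1\<close>, the instance \<open>l = j\<close> yields
        the ratio of the norms, \<open>norm (row i A) = norm (row j A) * A $ i $ j\<close>; this is
        substituted into the instance \<open>l = k\<close>.\<close>
      have "norm (row j A) * (A $ i $ j * A $ j $ k) = norm (row j A) * A $ i $ k"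
        using scaled [of j] scaled [of k] by (simp add: diag)
      then show ?thesis
        using nz [of j] by simp
    qed
    then show "A \<in> consistent_matrices"
      using pos by (simp add: consistent_matrices_def)
  qed
qed

theorem proposition2:
  fixes A :: "real ^ 'n::{finite,linorder} ^ 'n::{finite,linorder}"
  assumes "CARD('n) \<ge> 2"
    and "A \<in> reciprocal_matrices"
  shows "RIC A > 0 \<longleftrightarrow> A \<notin> consistent_matrices"
proof -
  let ?d = "\<lambda>i j. 1 - cos (row_angle A i j)"
  let ?S = "\<Sum>i\<in>UNIV. \<Sum>j\<in>{i<..}. ?d i j"
  let ?N = "real CARD('n) * (real CARD('n) - 1)"
  have N: "?N > 0"
    using assms(1) by simp
  \<comment> \<open>The constant terms 1 of \<open>?S\<close> count the pairs \<open>i < j\<close>,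
    of which there are \<open>?N / 2\<close>.\<close>
  have "2 * ?S = ?N - 2 * (\<Sum>i\<in>UNIV. \<Sum>j\<in>{i<..}. cos (row_angle A i j))"
    using sum_card_greaterThan by (simp add: sum_subtractf right_diff_distrib)
  then have "RIC A = 2 * ?S / ?N"
    using N assms(1) by (simp add: RIC_def diff_divide_distrib)
  then have "RIC A > 0 \<longleftrightarrow> ?S > 0"
    using N by (simp add: zero_less_divide_iff)
  also have "\<dots> \<longleftrightarrow> ?S \<noteq> 0"
    using sum_nonneg [of UNIV "\<lambda>i. \<Sum>j\<in>{i<..}. ?d i j"]
    by (simp add: sum_nonneg less_le)
  also have "?S = 0 \<longleftrightarrow> (\<forall>i j. i < j \<longrightarrow> cos (row_angle A i j) = 1)"
    by (auto simp: sum_nonneg_eq_0_iff sum_nonneg)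
  \<comment> \<open>Pairs with \<open>i > j\<close> follow by symmetry of the angle; on the diagonal
    a nonzero row has cosine 1 with itself.\<close>
  also have "\<dots> \<longleftrightarrow> (\<forall>i j. cos (row_angle A i j) = 1)"
  proof -
    have "cos (row_angle A i i) = 1" for i
      using row_reciprocal_nonzero [OF assms(2)]
      by (simp add: row_angle_def cos_vector_angle_eq_1_iff)
    then show ?thesis
      by (metis linorder_neqE row_angle_commute)
  qed
  also have "\<dots> \<longleftrightarrow> A \<in> consistent_matrices"
    using consistent_iff_cos_row_angle [OF assms(2)] by simp
  finally show ?thesis .
qed

end
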